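(* For every integer $k\ge0$, $$\sum_{n=k}^\infty S^B_{n,k}\,\frac{z^n}{n!}=\frac{1}{k!\,2^k}\,e^z\,(e^{2z}-1)^k$$ as formal power series in $z$.
   Context: A set partition of $[\pm n]=\{\pm1,\dots,\pm n\}$ of type $B$ is a set partition of $[\pm n]$ such that (i) if $B$ is a block then $-B=\{-b: b\in B\}$ is also a block, and (ii) there is at most one block with $B=-B$ (called the zero block). The non-zero blocks come in pairs $\{B,-B\}$, and each pair is counted as one (representative) non-zero block. $S^B_{n,k}$ (the Stirling number of the second kind of type $B$) is the number of set partitions of $[\pm n]$ of type $B$ with exactly $k$ (representative) non-zero blocks; $S^B_{0,0}=1$. *)

theory Defs
  imports Complex_Main "HOL-Library.Disjoint_Sets"
    "HOL-Computational_Algebra.Formal_Power_Series"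
begin

definition pm_set :: "nat \<Rightarrow> int set" where
  "pm_set n = {- int n..int n} - {0}"

text \<open>The negative of a block \<open>B\<close> is the image \<open>uminus ` B\<close>; beware that \<open>- B\<close> would be
  the set complement. \<open>partition_on\<close> requires all blocks to be nonempty.\<close>

definition type_B_partition :: "nat \<Rightarrow> int set set \<Rightarrow> bool" where
  "type_B_partition n P \<longleftrightarrow>
     partition_on (pm_set n) P \<and>
     (\<forall>B\<in>P. uminus ` B \<in> P) \<and>
     (\<forall>B\<in>P. \<forall>C\<in>P. B = uminus ` B \<longrightarrow> C = uminus ` C \<longrightarrow> B = C)"

text \<open>The pairs \<open>{B, -B}\<close> of non-zero blocks; each pair counts as one representative
  non-zero block.\<close>

definition nonzero_block_pairs :: "int set set \<Rightarrow> int set set set" where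
  "nonzero_block_pairs P = {{B, uminus ` B} | B. B \<in> P \<and> B \<noteq> uminus ` B}"

definition stirling_B :: "nat \<Rightarrow> nat \<Rightarrow> nat" where
  "stirling_B n k = card {P. type_B_partition n P \<and> card (nonzero_block_pairs P) = k}"

lemma stirling_B_0_0: "stirling_B 0 0 = 1"
proof -
  have "{P. type_B_partition 0 P \<and> card (nonzero_block_pairs P) = 0} = {{}}"
    by (auto simp: type_B_partition_def pm_set_def nonzero_block_pairs_def partition_on_empty)
  then show ?thesis
    by (simp add: stirling_B_def)
qed

end

theory Submission
  imports Defs
begin

text \<open>
  Both sides satisfy the same recurrence in \<open>n\<close>. On the combinatorial side it is
  \<open>S(n+1,k) = S(n,k-1) + (2k+1) S(n,k)\<close>, obtained by deleting \<open>m = n + 1\<close> and \<open>-m\<close> from a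
  partition of \<open>[\<plusminus>(n+1)]\<close>. What is lost is only which block contained \<open>m\<close>, and given the remaining partition \<open>Q\<close> this block
  can be \<open>{m}\<close>, which creates a new pair of non-zero blocks, or \<open>m\<close> can have joined one of
  the \<open>2k\<close> non-zero blocks of \<open>Q\<close>, or \<open>m\<close> and \<open>-m\<close> together belonged to the zero block,
  which counts as one further choice whether or not \<open>Q\<close> has a zero block. The lemmas
  \<open>symmetric_partition_extend\<close>, \<open>inj_on_extend\<close> and \<open>extend_surj\<close> say that the pair of \<open>Q\<close> and
  the block of \<open>m\<close> determines the partition and that all these choices occur.

  On the analytic side, \<open>G\<^sub>k = e\<^sup>z (e\<^sup>2\<^sup>z - 1)\<^sup>k / (k! 2\<^sup>k)\<close> satisfies
  \<open>G\<^sub>k' = G\<^sub>k\<^sub>-\<^sub>1 + (2k + 1) G\<^sub>k\<close>, because the derivative \<open>2 e\<^sup>2\<^sup>z\<close> of \<open>e\<^sup>2\<^sup>z - 1\<close>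
  is \<open>2 (e\<^sup>2\<^sup>z - 1) + 2\<close>. Reading off coefficients gives the recurrence for
  \<open>n! [z\<^sup>n] G\<^sub>k\<close>. The two sides also agree at \<open>n = 0\<close>.
\<close>

section \<open>Symmetric partitions\<close>

lemma mem_uminus_image_iff: "x \<in> uminus ` X \<longleftrightarrow> - x \<in> X" for x :: int
  by (metis image_iff minus_minus)

lemma uminus_image_uminus_image [simp]: "uminus ` uminus ` X = X" for X :: "int set"
  by (auto simp: mem_uminus_image_iff)

text \<open>The type \<open>B\<close> condition over an arbitrary ground set: taking a block and its negative
  out of a partition of \<open>[\<plusminus>n]\<close> leaves a ground set that is no longer of the form \<open>[\<plusminus>j]\<close>.\<close>

definition symmetric_partition :: "int set \<Rightarrow> int set set \<Rightarrow> bool" where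
  "symmetric_partition A P \<longleftrightarrow>
     partition_on A P \<and>
     (\<forall>B\<in>P. uminus ` B \<in> P) \<and>
     (\<forall>B\<in>P. \<forall>C\<in>P. B = uminus ` B \<longrightarrow> C = uminus ` C \<longrightarrow> B = C)"

definition nonzero_blocks :: "int set set \<Rightarrow> int set set" where
  "nonzero_blocks P = {B \<in> P. B \<noteq> uminus ` B}"

text \<open>A partition without zero block is treated as having an empty one, so that
  adjoining two opposite elements to the zero block always makes sense. As there is at most
  one symmetric block, the union is over at most one set.\<close>

definition zero_block :: "int set set \<Rightarrow> int set" where
  "zero_block P = \<Union> {B \<in> P. B = uminus ` B}"

lemma type_B_partition_iff: "type_B_partition n P \<longleftrightarrow> symmetric_partition (pm_set n) P"
  by (simp add: type_B_partition_def symmetric_partition_def)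

lemma symmetric_partitionD:
  assumes "symmetric_partition A P"
  shows "\<Union>P = A" "{} \<notin> P"
    "\<And>B C x. B \<in> P \<Longrightarrow> C \<in> P \<Longrightarrow> x \<in> B \<Longrightarrow> x \<in> C \<Longrightarrow> B = C"
    "\<And>B. B \<in> P \<Longrightarrow> uminus ` B \<in> P"
    "\<And>B C. B \<in> P \<Longrightarrow> C \<in> P \<Longrightarrow> B = uminus ` B \<Longrightarrow> C = uminus ` C \<Longrightarrow> B = C"
  using assms
  by (auto simp: symmetric_partition_def partition_on_def disjoint_def)

lemma symmetric_partitionI:
  assumes "\<Union>P = A" "{} \<notin> P"
    "\<And>B C x. B \<in> P \<Longrightarrow> C \<in> P \<Longrightarrow> x \<in> B \<Longrightarrow> x \<in> C \<Longrightarrow> B = C"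
    "\<And>B. B \<in> P \<Longrightarrow> uminus ` B \<in> P"
    "\<And>B C. B \<in> P \<Longrightarrow> C \<in> P \<Longrightarrow> B = uminus ` B \<Longrightarrow> C = uminus ` C \<Longrightarrow> B = C"
  shows "symmetric_partition A P"
  unfolding symmetric_partition_def
proof (intro conjI ballI impI)
  show "partition_on A P"
    using assms(1-3) by (intro partition_onI) (auto simp: disjnt_iff)
qed (fact assms(4), fact assms(5))

text \<open>Both \<open>X\<close> and \<open>-X\<close> are blocks, so they coincide as soon as they meet.\<close>

lemma block_cases:
  assumes "symmetric_partition A P" "X \<in> P"
  shows "X = uminus ` X \<or> X \<inter> uminus ` X = {}"
  using symmetric_partitionD(3,4)[OF assms(1)] assms(2) by blast

lemma remove_block_pair:
  assumes P: "symmetric_partition A P" and X: "X \<in> P"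
  shows "symmetric_partition (A - (X \<union> uminus ` X)) (P - {X, uminus ` X})"
proof (rule symmetric_partitionI)
  note D = symmetric_partitionD[OF P]
  show "\<Union> (P - {X, uminus ` X}) = A - (X \<union> uminus ` X)"
    using D(1) D(3) D(4)[OF X] X by blast
  show "uminus ` B \<in> P - {X, uminus ` X}" if "B \<in> P - {X, uminus ` X}" for B
    using that D(4) by (metis Diff_iff insert_iff singletonD uminus_image_uminus_image)
  show "B = C" if "B \<in> P - {X, uminus ` X}" "C \<in> P - {X, uminus ` X}" "x \<in> B" "x \<in> C" for B C x
    using that D(3) by (meson DiffD1)
  show "B = C" if "B \<in> P - {X, uminus ` X}" "C \<in> P - {X, uminus ` X}"
    "B = uminus ` B" "C = uminus ` C" for B C
    using D(5)[OF _ _ that(3,4)] that(1,2) by simp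
qed (use symmetric_partitionD(2)[OF P] in simp)

lemma no_zero_block_after_removal:
  assumes "symmetric_partition A P" "X \<in> P" "X = uminus ` X" "B \<in> P - {X, uminus ` X}"
  shows "B \<noteq> uminus ` B"
  using symmetric_partitionD(5)[OF assms(1) assms(2) _ assms(3)] assms(4) by auto

text \<open>The converse of \<open>remove_block_pair\<close>. Together the two lemmas allow one pair of opposite
  blocks to be exchanged for another, which is how all partitions below are built.
  A symmetric \<open>X\<close> becomes the zero block, so \<open>R\<close> must not have one already.\<close>

lemma insert_block_pair:
  assumes R: "symmetric_partition A R"
    and X: "X \<noteq> {}" "X = uminus ` X \<or> X \<inter> uminus ` X = {}" "(X \<union> uminus ` X) \<inter> A = {}"
    and zero: "\<And>B. X = uminus ` X \<Longrightarrow> B \<in> R \<Longrightarrow> B \<noteq> uminus ` B"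
    and A': "A' = A \<union> X \<union> uminus ` X"
  shows "symmetric_partition A' (R \<union> {X, uminus ` X})"
proof (rule symmetric_partitionI)
  note D = symmetric_partitionD[OF R]
  show "\<Union> (R \<union> {X, uminus ` X}) = A'" using D(1) A' by auto
  show "{} \<notin> R \<union> {X, uminus ` X}" using D(2) X(1) by auto
  show "B = C" if BC: "B \<in> R \<union> {X, uminus ` X}" "C \<in> R \<union> {X, uminus ` X}" "x \<in> B" "x \<in> C"
    for B C x
  proof (cases "x \<in> A")
    case True
    then have "x \<notin> X" "x \<notin> uminus ` X" using X(3) by blast+
    then have "B \<in> R" "C \<in> R" using BC by auto
    then show ?thesis using D(3) BC(3,4) by blast
  next
    case False
    then have "B \<notin> R" "C \<notin> R" using D(1) BC(3,4) by blast+
    then have "B \<in> {X, uminus ` X}" "C \<in> {X, uminus ` X}" using BC(1,2) by blast+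
    then show ?thesis using X(2)
    proof (elim disjE)
      assume "B \<in> {X, uminus ` X}" "C \<in> {X, uminus ` X}" "X \<inter> uminus ` X = {}"
      then show ?thesis using BC(3,4) by blast
    qed simp
  qed
  show "uminus ` B \<in> R \<union> {X, uminus ` X}" if "B \<in> R \<union> {X, uminus ` X}" for B
    using that D(4) by auto
  show "B = C" if "B \<in> R \<union> {X, uminus ` X}" "C \<in> R \<union> {X, uminus ` X}"
    "B = uminus ` B" "C = uminus ` C" for B C
  proof (cases "X = uminus ` X")
    case True
    then show ?thesis using zero[OF True] that by blast
  next
    case False
    have "B \<noteq> X" "B \<noteq> uminus ` X" "C \<noteq> X" "C \<noteq> uminus ` X"
      using that(3,4) False by (metis, metis uminus_image_uminus_image, metis,
        metis uminus_image_uminus_image)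
    then have "B \<in> R" "C \<in> R" using that(1,2) by simp_all
    then show ?thesis by (rule D(5)) (fact that(3), fact that(4))
  qed
qed

section \<open>Inserting a pair of opposite elements\<close>

text \<open>The possible blocks of \<open>m\<close> in a partition that restricts to \<open>Q\<close> after deletion of \<open>m\<close> and
  \<open>-m\<close>.\<close>

definition new_blocks :: "int \<Rightarrow> int set set \<Rightarrow> int set set" where
  "new_blocks m Q = insert {m} (insert ({m, - m} \<union> zero_block Q) (insert m ` nonzero_blocks Q))"

text \<open>The partition in which the block of \<open>m\<close> is \<open>X\<close>: the traces of \<open>X\<close> and \<open>-X\<close> on the old
  ground set give way to \<open>X\<close> and \<open>-X\<close>. If the trace is empty, nothing is taken away, since
  the empty set is not a block of \<open>Q\<close>.\<close>

definition extend :: "int \<Rightarrow> int set set \<Rightarrow> int set \<Rightarrow> int set set" where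
  "extend m Q X = (Q - {X - {m, - m}, uminus ` (X - {m, - m})}) \<union> {X, uminus ` X}"

lemma zero_block_eq:
  assumes "symmetric_partition A Q" "Z \<in> Q" "Z = uminus ` Z"
  shows "zero_block Q = Z"
proof -
  have "B \<in> Q \<and> B = uminus ` B \<longleftrightarrow> B = Z" for B
    using symmetric_partitionD(5)[OF assms(1) _ assms(2) _ assms(3)] assms(2,3) by metis
  then show ?thesis by (simp only: zero_block_def) simp
qed

lemma zero_block_cases:
  assumes "symmetric_partition A Q"
  obtains "zero_block Q = {}" "\<And>B. B \<in> Q \<Longrightarrow> B \<noteq> uminus ` B"
  | "zero_block Q \<in> Q" "zero_block Q = uminus ` zero_block Q"
proof (cases "\<exists>B\<in>Q. B = uminus ` B")
  case True
  then obtain B where "B \<in> Q" "B = uminus ` B" by blast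
  moreover from this have "zero_block Q = B" by (rule zero_block_eq[OF assms])
  ultimately show ?thesis using that(2) by simp
next
  case False
  then have "{B \<in> Q. B = uminus ` B} = {}" by auto
  then have "zero_block Q = {}" by (simp only: zero_block_def Union_empty)
  then show ?thesis using that(1) False by simp
qed

lemma uminus_image_minus_pair:
  "uminus ` (X - {m, - m}) = uminus ` X - {m, - m}" for m :: int
  by (auto simp: mem_uminus_image_iff)

context
  fixes A :: "int set" and m :: int
  assumes m: "m \<noteq> 0" "m \<notin> A" "- m \<notin> A"
begin

lemma block_avoids:
  assumes "symmetric_partition A Q" "C \<in> Q"
  shows "m \<notin> C" "- m \<notin> C"
  using symmetric_partitionD(1)[OF assms(1)] assms(2) m by blast+

text \<open>Adjoining \<open>m\<close> and \<open>-m\<close> to the zero block is split into two cases, according to whether \<open>Q\<close>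
  has a zero block, because \<open>extend\<close> replaces a block of \<open>Q\<close> only if there is one to replace.\<close>

lemma new_blocks_cases:
  assumes Q: "symmetric_partition A Q" and X: "X \<in> new_blocks m Q"
  obtains (new) "X = {m}" "X - {m, - m} = {}" "X \<inter> uminus ` X = {}" "X \<noteq> uminus ` X"
  | (zero_new) "X = {m, - m}" "X - {m, - m} = {}" "X = uminus ` X"
      "\<And>B. B \<in> Q \<Longrightarrow> B \<noteq> uminus ` B"
  | (zero_old) C where "X = {m, - m} \<union> C" "X - {m, - m} = C" "X = uminus ` X"
      "C \<in> Q" "C = uminus ` C"
  | (old) C where "X = insert m C" "X - {m, - m} = C" "X \<inter> uminus ` X = {}" "X \<noteq> uminus ` X"
      "C \<in> Q" "C \<noteq> uminus ` C"
proof -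
  consider "X = {m}" | "X = {m, - m} \<union> zero_block Q"
    | C where "C \<in> Q" "C \<noteq> uminus ` C" "X = insert m C"
    using X by (auto simp: new_blocks_def nonzero_blocks_def)
  then show ?thesis
  proof cases
    case 1
    then show ?thesis using new m(1) by auto
  next
    case 2
    show ?thesis
    proof (cases rule: zero_block_cases[OF Q])
      case 1
      with 2 show ?thesis using zero_new by auto
    next
      case z: 2
      show ?thesis
        by (rule zero_old[OF 2 _ _ z])
          (use 2 z block_avoids[OF Q z(1)] in auto)
    qed
  next
    case (3 C)
    have "C \<inter> uminus ` C = {}" using block_cases[OF Q 3(1)] 3(2) by blast
    then have "X \<inter> uminus ` X = {}"
      using 3 block_avoids[OF Q 3(1)] m(1) by (auto simp: mem_uminus_image_iff)
    then show ?thesis using old[of C] 3 block_avoids[OF Q 3(1)] by blast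
  qed
qed

lemma symmetric_partition_extend:
  assumes Q: "symmetric_partition A Q" and X: "X \<in> new_blocks m Q"
  shows "symmetric_partition (A \<union> {m, - m}) (extend m Q X)"
proof -
  note D = symmetric_partitionD[OF Q]
  show ?thesis
    using Q X
  proof (cases rule: new_blocks_cases)
    case new
    then have "extend m Q X = Q \<union> {X, uminus ` X}" using D(2) by (auto simp: extend_def)
    moreover have "symmetric_partition (A \<union> {m, - m}) (Q \<union> {X, uminus ` X})"
      by (rule insert_block_pair[OF Q]) (use new m in auto)
    ultimately show ?thesis by simp
  next
    case zero_new
    then have "extend m Q X = Q \<union> {X, uminus ` X}" using D(2) by (auto simp: extend_def)
    moreover have "symmetric_partition (A \<union> {m, - m}) (Q \<union> {X, uminus ` X})"
      by (rule insert_block_pair[OF Q]) (use zero_new m in auto)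
    ultimately show ?thesis by simp
  next
    case (zero_old C)
    have "symmetric_partition (A \<union> {m, - m}) ((Q - {C, uminus ` C}) \<union> {X, uminus ` X})"
    proof (rule insert_block_pair[OF remove_block_pair[OF Q zero_old(4)]])
      show "B \<noteq> uminus ` B" if "B \<in> Q - {C, uminus ` C}" for B
        using no_zero_block_after_removal[OF Q zero_old(4,5) that] .
    qed (use zero_old D(1) m in auto)
    then show ?thesis by (simp add: extend_def zero_old(2))
  next
    case (old C)
    have "symmetric_partition (A \<union> {m, - m}) ((Q - {C, uminus ` C}) \<union> {X, uminus ` X})"
      by (rule insert_block_pair[OF remove_block_pair[OF Q old(5)]])
        (use old D(1) D(4)[OF old(5)] m in auto)
    then show ?thesis by (simp add: extend_def old(2))
  qed
qed

text \<open>The block \<open>X\<close> is recovered as the block of \<open>m\<close>, and \<open>Q\<close> is recovered by putting the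
  nonempty traces of \<open>X\<close> and \<open>-X\<close> back in place of \<open>X\<close> and \<open>-X\<close>.\<close>

lemma inj_on_extend:
  "inj_on (\<lambda>(Q, X). extend m Q X) (SIGMA Q:{Q. symmetric_partition A Q}. new_blocks m Q)"
proof -
  have m_in: "m \<in> X" if "X \<in> new_blocks m Q" for X Q
    using that by (auto simp: new_blocks_def)
  have recover: "Q = (extend m Q X - {X, uminus ` X}) \<union> ({X - {m, - m}, uminus ` (X - {m, - m})} - {{}})"
    if Q: "symmetric_partition A Q" and X: "X \<in> new_blocks m Q" for Q X
  proof -
    define V where "V = {X - {m, - m}, uminus ` (X - {m, - m})}"
    define W where "W = {X, uminus ` X}"
    have "X \<notin> Q" "uminus ` X \<notin> Q"
      using block_avoids[OF Q] m_in[OF X] by (metis, metis imageI)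
    then have "W \<inter> Q = {}" by (simp add: W_def)
    moreover have "V - {{}} \<subseteq> Q"
      unfolding V_def using Q X symmetric_partitionD(4)[OF Q]
      by (cases rule: new_blocks_cases) auto
    ultimately have "Q = ((Q - V) \<union> W - W) \<union> (V - {{}})"
      using symmetric_partitionD(2)[OF Q] by blast
    then show ?thesis by (simp only: extend_def V_def W_def)
  qed
  have "Q = Q' \<and> X = X'"
    if Q: "symmetric_partition A Q" "X \<in> new_blocks m Q"
      and Q': "symmetric_partition A Q'" "X' \<in> new_blocks m Q'"
      and eq: "extend m Q X = extend m Q' X'" for Q X Q' X'
  proof -
    have "X \<in> extend m Q X" "X' \<in> extend m Q' X'"
      by (simp_all add: extend_def)
    then have "X \<in> extend m Q X" "X' \<in> extend m Q X"
      by (simp_all only: eq)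
    then have "X = X'"
      by (rule symmetric_partitionD(3)[OF symmetric_partition_extend[OF Q] _ _ m_in[OF Q(2)] m_in[OF Q'(2)]])
    have "Q = (extend m Q' X' - {X, uminus ` X}) \<union> ({X - {m, - m}, uminus ` (X - {m, - m})} - {{}})"
      by (rule recover[OF Q, unfolded eq])
    also have "\<dots> = Q'"
      unfolding \<open>X = X'\<close> by (rule recover[OF Q', symmetric])
    finally show ?thesis using \<open>X = X'\<close> by simp
  qed
  then show ?thesis by (auto simp: inj_on_def)
qed

text \<open>Take for \<open>X\<close> the block of \<open>m\<close>, and delete \<open>m\<close> and \<open>-m\<close> from \<open>X\<close> and \<open>-X\<close>. If nothing
  remains of \<open>X\<close>, these blocks vanish; otherwise the trace \<open>C\<close> is a block of the
  restriction, symmetric exactly if \<open>X\<close> is.\<close>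

lemma extend_surj:
  assumes P: "symmetric_partition (A \<union> {m, - m}) P"
  obtains Q X where "symmetric_partition A Q" "X \<in> new_blocks m Q" "P = extend m Q X"
proof -
  note D = symmetric_partitionD[OF P]
  obtain X where X: "X \<in> P" "m \<in> X" using D(1) by blast
  define R where "R = P - {X, uminus ` X}"
  define C where "C = X - {m, - m}"
  have R: "symmetric_partition (A \<union> {m, - m} - (X \<union> uminus ` X)) R"
    unfolding R_def by (rule remove_block_pair[OF P X(1)])
  have negC: "uminus ` C = uminus ` X - {m, - m}"
    unfolding C_def by (rule uminus_image_minus_pair)
  have mX: "- m \<in> uminus ` X" using X(2) by auto
  have XA: "X \<subseteq> A \<union> {m, - m}" "uminus ` X \<subseteq> A \<union> {m, - m}"
    using D(1) D(4)[OF X(1)] X(1) by blast+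
  have P_eq: "P = R \<union> {X, uminus ` X}" using X(1) D(4) by (auto simp: R_def)
  have zero: "B \<noteq> uminus ` B" if "X = uminus ` X" "B \<in> R" for B
    using no_zero_block_after_removal[OF P X(1) that(1)] that(2) by (simp add: R_def)
  show ?thesis
  proof (cases "C = {}")
    case True
    have "A \<union> {m, - m} - (X \<union> uminus ` X) = A"
      using True negC X(2) mX m by (auto simp: C_def)
    then have RA: "symmetric_partition A R" using R by simp
    have "X = {m} \<or> X = {m, - m}" using True X(2) by (auto simp: C_def)
    moreover have "zero_block R = {}" if "X = {m, - m}"
      using zero that unfolding zero_block_def by auto
    ultimately have "X \<in> new_blocks m R" by (auto simp: new_blocks_def)
    moreover have "P = extend m R X"
      unfolding extend_def C_def[symmetric] True using P_eq symmetric_partitionD(2)[OF R] by simp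
    ultimately show ?thesis using that RA by blast
  next
    case False
    define Q where "Q = R \<union> {C, uminus ` C}"
    have C_cases: "C = uminus ` C \<and> X = uminus ` X \<or> C \<inter> uminus ` C = {} \<and> X \<inter> uminus ` X = {}"
      using block_cases[OF P X(1)] negC unfolding C_def by blast
    have "symmetric_partition A Q"
      unfolding Q_def
    proof (rule insert_block_pair[OF R False])
      show "C = uminus ` C \<or> C \<inter> uminus ` C = {}" using C_cases by blast
      show "(C \<union> uminus ` C) \<inter> (A \<union> {m, - m} - (X \<union> uminus ` X)) = {}"
        using negC C_def by blast
      show "B \<noteq> uminus ` B" if "C = uminus ` C" "B \<in> R" for B
        using C_cases that False zero by blast
      show "A = A \<union> {m, - m} - (X \<union> uminus ` X) \<union> C \<union> uminus ` C"
      proof -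
        have "A = A \<union> {m, - m} - (X \<union> Y) \<union> (X - {m, - m}) \<union> (Y - {m, - m})"
          if "m \<in> X" "- m \<in> Y" "X \<subseteq> A \<union> {m, - m}" "Y \<subseteq> A \<union> {m, - m}" for Y
          using that m by blast
        from this[OF X(2) mX XA] show ?thesis unfolding negC unfolding C_def .
      qed
    qed
    moreover have "X \<in> new_blocks m Q"
    proof (cases "X = uminus ` X")
      case True
      then have "C = uminus ` C" using C_def negC by metis
      then have "zero_block Q = C"
        by (intro zero_block_eq[OF \<open>symmetric_partition A Q\<close>]) (simp_all add: Q_def)
      moreover have "- m \<in> X" using True mX by metis
      then have "X = {m, - m} \<union> C" using X(2) by (auto simp: C_def)
      ultimately show ?thesis by (simp add: new_blocks_def)
    next
      case nz: False
      then have disj: "C \<inter> uminus ` C = {}" "X \<inter> uminus ` X = {}" using C_cases by blast+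
      have "C \<noteq> uminus ` C" using disj(1) False by (metis Int_absorb)
      moreover have "X = insert m C" using disj(2) X(2) mX by (auto simp: C_def)
      ultimately show ?thesis by (auto simp: new_blocks_def nonzero_blocks_def Q_def)
    qed
    moreover have "P = extend m Q X"
    proof -
      have "C \<notin> R" "uminus ` C \<notin> R"
        using symmetric_partitionD(1)[OF R] False C_def negC by blast+
      then have "Q - {C, uminus ` C} = R" by (auto simp: Q_def)
      then show ?thesis using P_eq by (simp only: extend_def C_def)
    qed
    ultimately show ?thesis using that by blast
  qed
qed

text \<open>Only \<open>X = {m}\<close> adds non-zero blocks, namely \<open>{m}\<close> and \<open>{-m}\<close>. The other choices
  exchange a pair of non-zero blocks for another, or alter only the zero block.\<close>

lemma card_nonzero_blocks_extend:
  assumes Q: "symmetric_partition A Q" and X: "X \<in> new_blocks m Q" and fin: "finite Q"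
  shows "card (nonzero_blocks (extend m Q X)) =
    card (nonzero_blocks Q) + (if X = {m} then 2 else 0)"
proof -
  have fin': "finite (nonzero_blocks Q)" using fin by (simp add: nonzero_blocks_def)
  have mX: "m \<in> X" using X by (auto simp: new_blocks_def)
  have notin: "X \<notin> Q" "uminus ` X \<notin> Q"
    using block_avoids[OF Q] mX by (metis, metis imageI)
  show ?thesis
    using Q X
  proof (cases rule: new_blocks_cases)
    case new
    then have "nonzero_blocks (extend m Q X) = nonzero_blocks Q \<union> {X, uminus ` X}"
      using symmetric_partitionD(2)[OF Q] by (auto simp: extend_def nonzero_blocks_def)
    moreover have "card (nonzero_blocks Q \<union> {X, uminus ` X}) = card (nonzero_blocks Q) + 2"
      using new(4) notin fin' by (subst card_Un_disjoint) (auto simp: nonzero_blocks_def)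
    ultimately show ?thesis using new by simp
  next
    case zero_new
    then have "nonzero_blocks (extend m Q X) = nonzero_blocks Q"
      using symmetric_partitionD(2)[OF Q] by (auto simp: extend_def nonzero_blocks_def)
    then show ?thesis using zero_new m(1) by simp
  next
    case (zero_old C)
    have "B \<in> nonzero_blocks (extend m Q X) \<longleftrightarrow> B \<in> nonzero_blocks Q" for B
      unfolding extend_def nonzero_blocks_def zero_old(2) mem_Collect_eq Un_iff Diff_iff
        insert_iff empty_iff
      using zero_old(3,5) by metis
    then have "nonzero_blocks (extend m Q X) = nonzero_blocks Q" by blast
    then show ?thesis using zero_old m(1) by auto
  next
    case (old C)
    have "X \<noteq> {m}"
    proof
      assume "X = {m}"
      then have "C = {}" using old(2) by simp
      then show False using old(5) symmetric_partitionD(2)[OF Q] by simp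
    qed
    have C: "{C, uminus ` C} \<subseteq> nonzero_blocks Q"
      using old symmetric_partitionD(4)[OF Q] by (auto simp: nonzero_blocks_def)
    have "nonzero_blocks (extend m Q X) = (nonzero_blocks Q - {C, uminus ` C}) \<union> {X, uminus ` X}"
    proof -
      \<comment> \<open>Naming the set of asymmetric sets reduces the claim to set algebra.\<close>
      define N :: "int set set" where "N = {B. B \<noteq> uminus ` B}"
      have N: "nonzero_blocks P = P \<inter> N" for P by (auto simp: nonzero_blocks_def N_def)
      have "X \<in> N" "uminus ` X \<in> N" using old(4) by (auto simp: N_def)
      then show ?thesis
        unfolding extend_def old(2) N by blast
    qed
    also have "card \<dots> = card (nonzero_blocks Q - {C, uminus ` C}) + card {X, uminus ` X}"
      by (rule card_Un_disjoint) (use fin' notin in \<open>auto simp: nonzero_blocks_def\<close>)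
    also have "\<dots> = card (nonzero_blocks Q)"
      using card_mono[OF fin' C] card_Diff_subset[OF _ C] old(4,6) by simp
    finally show ?thesis using \<open>X \<noteq> {m}\<close> by simp
  qed
qed

text \<open>The choices other than \<open>{m}\<close> are one for the zero block and one for each non-zero block.
  Those of the latter kind do not contain \<open>-m\<close>, which separates them from the former.\<close>

lemma card_new_blocks:
  assumes Q: "symmetric_partition A Q" and fin: "finite Q"
  shows "finite (new_blocks m Q)"
    "card (new_blocks m Q - {{m}}) = Suc (card (nonzero_blocks Q))"
proof -
  have fin': "finite (nonzero_blocks Q)" using fin by (simp add: nonzero_blocks_def)
  then show "finite (new_blocks m Q)" by (simp add: new_blocks_def)
  have avoid: "m \<notin> C \<and> - m \<notin> C \<and> C \<noteq> {}" if "C \<in> nonzero_blocks Q" for C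
    using that block_avoids[OF Q] symmetric_partitionD(2)[OF Q] by (auto simp: nonzero_blocks_def)
  have "new_blocks m Q - {{m}} = insert ({m, - m} \<union> zero_block Q) (insert m ` nonzero_blocks Q)"
    using avoid m(1) by (auto simp: new_blocks_def)
  moreover have "{m, - m} \<union> zero_block Q \<notin> insert m ` nonzero_blocks Q"
  proof
    assume "{m, - m} \<union> zero_block Q \<in> insert m ` nonzero_blocks Q"
    then obtain C where C: "C \<in> nonzero_blocks Q" and eq: "{m, - m} \<union> zero_block Q = insert m C"
      by (rule imageE)
    have "- m \<in> insert m C" unfolding eq[symmetric] by simp
    then show False using avoid[OF C] m(1) by simp
  qed
  moreover have "inj_on (insert m) (nonzero_blocks Q)"
    using avoid by (auto intro!: inj_onI simp: insert_ident)
  ultimately show "card (new_blocks m Q - {{m}}) = Suc (card (nonzero_blocks Q))"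
    using fin' by (simp add: card_image)
qed

end

section \<open>The recurrence\<close>

text \<open>It is easier to count non-zero blocks than pairs, since \<open>m\<close> may join either member of a
  pair; the pairs split the non-zero blocks into classes of size two.\<close>

lemma card_nonzero_blocks:
  assumes P: "symmetric_partition A P" and fin: "finite P"
  shows "card (nonzero_blocks P) = 2 * card (nonzero_block_pairs P)"
proof -
  have neg: "uminus ` B \<in> nonzero_blocks P" if "B \<in> nonzero_blocks P" for B
    using that symmetric_partitionD(4)[OF P] by (auto simp: nonzero_blocks_def)
  have "nonzero_block_pairs P = (\<lambda>B. {B, uminus ` B}) ` nonzero_blocks P"
    unfolding nonzero_block_pairs_def nonzero_blocks_def by blast
  then have Un: "\<Union> (nonzero_block_pairs P) = nonzero_blocks P"
    using neg by simp blast
  have fin': "finite (nonzero_blocks P)" using fin by (simp add: nonzero_blocks_def)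
  have "2 * card (nonzero_block_pairs P) = card (\<Union> (nonzero_block_pairs P))"
  proof (rule card_partition)
    show "finite (\<Union> (nonzero_block_pairs P))" using Un fin' by simp
    then show "finite (nonzero_block_pairs P)" by (rule finite_UnionD)
    show "card c = 2" if "c \<in> nonzero_block_pairs P" for c
      using that unfolding nonzero_block_pairs_def card_2_iff by blast
    show "c \<inter> d = {}" if "c \<in> nonzero_block_pairs P" "d \<in> nonzero_block_pairs P" "c \<noteq> d" for c d
    proof -
      have pair: "c = {E, uminus ` E}" if "c \<in> nonzero_block_pairs P" "E \<in> c" for c E
      proof -
        obtain B where B: "c = {B, uminus ` B}"
          using \<open>c \<in> nonzero_block_pairs P\<close> unfolding nonzero_block_pairs_def by blast
        then have "E = B \<or> E = uminus ` B" using \<open>E \<in> c\<close> by simp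
        then show ?thesis unfolding B by (elim disjE) (simp_all add: insert_commute)
      qed
      have False if "E \<in> c \<inter> d" for E
        using pair[of c E] pair[of d E] that \<open>c \<in> _\<close> \<open>d \<in> _\<close> \<open>c \<noteq> d\<close> by simp
      then show ?thesis by blast
    qed
  qed
  then show ?thesis using Un by simp
qed

lemma finite_pm_set: "finite (pm_set n)"
  by (simp add: pm_set_def)

lemma finite_type_B_partitions: "finite {P. symmetric_partition (pm_set n) P}"
  by (rule finite_subset[OF _ finitely_many_partition_on[OF finite_pm_set]])
    (auto simp: symmetric_partition_def)

lemma finite_type_B_partition: "symmetric_partition (pm_set n) P \<Longrightarrow> finite P"
  unfolding symmetric_partition_def by (elim conjE) (rule finite_elements[OF finite_pm_set])

lemma stirling_B_eq:
  "stirling_B n k = card {P. symmetric_partition (pm_set n) P \<and> card (nonzero_blocks P) = 2 * k}"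
  unfolding stirling_B_def type_B_partition_iff
  by (rule arg_cong[of _ _ card]) (auto simp: card_nonzero_blocks[OF _ finite_type_B_partition])

text \<open>The index set \<open>E\<close> of the bijection has one part for each summand: partitions with \<open>k - 1\<close>
  pairs that receive the new block \<open>{m}\<close>, and partitions with \<open>k\<close> pairs together with one of
  the other \<open>2k + 1\<close> choices.\<close>

lemma stirling_B_Suc:
  "stirling_B (Suc n) k = (if k = 0 then 0 else stirling_B n (k - 1)) + (2 * k + 1) * stirling_B n k"
proof -
  define m where "m = int (Suc n)"
  define T where "T = (\<lambda>n k. {P. symmetric_partition (pm_set n) P \<and> card (nonzero_blocks P) = 2 * k})"
  \<comment> \<open>For \<open>k = 0\<close> the truncated difference \<open>k - 1\<close> gives \<open>T n 0\<close>, while the recurrence has no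
    such term.\<close>
  define U where "U = (if k = 0 then {} else T n (k - 1))"
  define E where "E = (U \<times> {{m}}) \<union> (SIGMA Q:T n k. new_blocks m Q - {{m}})"
  have m: "m \<noteq> 0" "m \<notin> pm_set n" "- m \<notin> pm_set n" by (auto simp: m_def pm_set_def)
  have pm: "pm_set (Suc n) = pm_set n \<union> {m, - m}" by (auto simp: m_def pm_set_def)
  have S: "stirling_B n k = card (T n k)" for n k by (simp add: stirling_B_eq T_def)
  have fin: "finite (T n k)" for k
    by (rule finite_subset[OF _ finite_type_B_partitions]) (auto simp: T_def)
  have card_ext: "card (nonzero_blocks (extend m Q X)) =
      card (nonzero_blocks Q) + (if X = {m} then 2 else 0)"
    if "symmetric_partition (pm_set n) Q" "X \<in> new_blocks m Q" for Q X
    using card_nonzero_blocks_extend[OF m that finite_type_B_partition[OF that(1)]] .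
  have E: "E = {(Q, X). symmetric_partition (pm_set n) Q \<and> X \<in> new_blocks m Q \<and>
      card (nonzero_blocks (extend m Q X)) = 2 * k}"
  proof -
    have "(Q, X) \<in> E \<longleftrightarrow> symmetric_partition (pm_set n) Q \<and> X \<in> new_blocks m Q \<and>
      card (nonzero_blocks (extend m Q X)) = 2 * k" for Q X
    proof (cases "symmetric_partition (pm_set n) Q \<and> X \<in> new_blocks m Q")
      case True
      then show ?thesis using card_ext[of Q X] by (auto simp: E_def U_def T_def)
    next
      case False
      then show ?thesis by (auto simp: E_def U_def T_def new_blocks_def split: if_splits)
    qed
    then show ?thesis by auto
  qed
  have "bij_betw (\<lambda>(Q, X). extend m Q X) E (T (Suc n) k)"
    unfolding bij_betw_def
  proof
    show "inj_on (\<lambda>(Q, X). extend m Q X) E"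
      by (rule inj_on_subset[OF inj_on_extend[OF m]]) (auto simp: E)
    have "P \<in> (\<lambda>(Q, X). extend m Q X) ` E" if P: "P \<in> T (Suc n) k" for P
    proof -
      have "symmetric_partition (pm_set n \<union> {m, - m}) P" using P pm by (simp add: T_def)
      then obtain Q X where QX: "symmetric_partition (pm_set n) Q" "X \<in> new_blocks m Q"
        "P = extend m Q X"
        using extend_surj[OF m] by blast
      then have "(Q, X) \<in> E" using P by (simp add: E T_def)
      then show ?thesis using QX(3) by force
    qed
    then show "(\<lambda>(Q, X). extend m Q X) ` E = T (Suc n) k"
      using symmetric_partition_extend[OF m] by (auto simp: E T_def pm)
  qed
  then have "stirling_B (Suc n) k = card E" using S bij_betw_same_card by metis
  also have "\<dots> = card U + card (SIGMA Q:T n k. new_blocks m Q - {{m}})"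
  proof -
    have "finite (SIGMA Q:T n k. new_blocks m Q - {{m}})"
      using fin card_new_blocks(1)[OF m] finite_type_B_partition by (auto simp: T_def)
    then show ?thesis
      using fin unfolding E_def
      by (subst card_Un_disjoint) (auto simp: U_def card_cartesian_product)
  qed
  also have "card (SIGMA Q:T n k. new_blocks m Q - {{m}}) = (\<Sum>Q\<in>T n k. card (new_blocks m Q - {{m}}))"
    using fin card_new_blocks(1)[OF m] finite_type_B_partition
    by (intro card_SigmaI) (auto simp: T_def)
  also have "\<dots> = (\<Sum>Q\<in>T n k. 2 * k + 1)"
    using card_new_blocks(2)[OF m] finite_type_B_partition by (intro sum.cong) (auto simp: T_def)
  also have "\<dots> = (2 * k + 1) * stirling_B n k" by (simp add: S)
  also have "card U = (if k = 0 then 0 else stirling_B n (k - 1))" by (simp add: U_def S)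
  finally show ?thesis .
qed

lemma stirling_B_0: "stirling_B 0 k = (if k = 0 then 1 else 0)"
proof -
  have "{P. type_B_partition 0 P \<and> card (nonzero_block_pairs P) = k} = (if k = 0 then {{}} else {})"
    by (auto simp: type_B_partition_def pm_set_def nonzero_block_pairs_def partition_on_empty)
  then show ?thesis by (simp add: stirling_B_def)
qed

lemma stirling_B_eq_0: "n < k \<Longrightarrow> stirling_B n k = 0"
  by (induction n arbitrary: k) (auto simp: stirling_B_0 stirling_B_Suc)

section \<open>The generating function\<close>

text \<open>With \<open>u = e\<^sup>2\<^sup>z - 1\<close> one has \<open>u' = 2 (u + 1)\<close>. The summand \<open>2 u\<close> turns
  \<open>k u\<^sup>k\<^sup>-\<^sup>1 u'\<close> into a multiple of \<open>u\<^sup>k\<close>, and the summand \<open>2\<close> produces \<open>G\<^sub>k\<^sub>-\<^sub>1\<close>, as the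
  factor \<open>2 k\<close> adjusts the normalisation \<open>1 / (k! 2\<^sup>k)\<close> to that of \<open>k - 1\<close>.\<close>

lemma fps_deriv_stirling_B_gf:
  fixes G :: "nat \<Rightarrow> 'a :: field_char_0 fps"
  defines "G \<equiv> \<lambda>k. fps_const (1 / (fact k * 2 ^ k)) * fps_exp 1 * (fps_exp 2 - 1) ^ k"
  shows "fps_deriv (G k) = (if k = 0 then 0 else G (k - 1)) + fps_const (of_nat (2 * k + 1)) * G k"
proof (cases k)
  case 0
  then show ?thesis by (simp add: G_def)
next
  case (Suc j)
  define u :: "'a fps" where "u = fps_exp 2 - 1"
  define e :: "'a fps" where "e = fps_exp 1"
  define c :: "'a \<Rightarrow> 'a fps" where "c = fps_const"
  define a :: 'a where "a = 1 / (fact k * 2 ^ k)"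
  have a: "1 / (fact j * 2 ^ j) = 2 * of_nat k * a"
    using Suc by (simp add: a_def field_simps del: of_nat_Suc)
  have e': "fps_deriv e = e" by (simp add: e_def)
  have u': "fps_deriv u = c 2 * (u + 1)" by (simp add: u_def c_def)
  have c': "fps_deriv (c x) = 0" for x by (simp add: c_def)
  have pow: "fps_deriv (u ^ k) = c (of_nat k) * (c 2 * (u + 1)) * u ^ j"
    by (simp only: fps_deriv_power u' c_def Suc diff_Suc_1)
  have G_k: "G k = c a * e * u ^ k" by (simp only: G_def a_def u_def e_def c_def)
  have G_j: "G j = c (2 * of_nat k * a) * e * u ^ j" by (simp only: G_def a u_def e_def c_def)
  from G_k have "fps_deriv (G k) = c a * (e * u ^ k + e * (c (of_nat k) * (c 2 * (u + 1)) * u ^ j))"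
    by (simp only: fps_deriv_mult pow c' e') (simp add: algebra_simps)
  also have "\<dots> = c (2 * of_nat k * a) * e * u ^ j + c (of_nat (2 * k + 1)) * (c a * e * u ^ k)"
  proof -
    have "c (2 * of_nat k * a) = c 2 * c (of_nat k) * c a" by (simp add: c_def)
    moreover have "c (of_nat (2 * k + 1)) = c 2 * c (of_nat k) + c 1"
      by (simp only: c_def fps_const_mult fps_const_add) (simp add: add.commute)
    moreover have "c 1 = 1" by (simp add: c_def)
    moreover have "u ^ k = u * u ^ j" by (simp add: Suc)
    ultimately show ?thesis by (simp only:) (simp add: algebra_simps)
  qed
  also have "\<dots> = G j + c (of_nat (2 * k + 1)) * G k"
    by (simp only: G_j G_k)
  finally show ?thesis using Suc by (simp add: c_def)
qed

lemma stirling_B_gf_nth: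
  "fps_nth (fps_const (1 / (fact k * 2 ^ k)) * fps_exp 1 * (fps_exp 2 - 1 :: 'a :: field_char_0 fps) ^ k) n
    = of_nat (stirling_B n k) / fact n"
proof -
  define G :: "nat \<Rightarrow> 'a fps" where
    "G = (\<lambda>k. fps_const (1 / (fact k * 2 ^ k)) * fps_exp 1 * (fps_exp 2 - 1) ^ k)"
  have "fps_nth (G k) n = of_nat (stirling_B n k) / fact n"
  proof (induction n arbitrary: k)
    case 0
    show ?case by (simp add: G_def stirling_B_0 fps_nth_power_0)
  next
    case (Suc n)
    have "of_nat (Suc n) * fps_nth (G k) (Suc n) = fps_nth (fps_deriv (G k)) n"
      by simp
    also have "fps_deriv (G k) = (if k = 0 then 0 else G (k - 1)) + fps_const (of_nat (2 * k + 1)) * G k"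
      unfolding G_def by (rule fps_deriv_stirling_B_gf)
    also have "fps_nth \<dots> n = of_nat (stirling_B (Suc n) k) / fact n"
      using Suc.IH by (simp add: stirling_B_Suc add_divide_distrib algebra_simps)
    finally show ?case by (simp add: field_simps del: of_nat_Suc)
  qed
  then show ?thesis by (simp add: G_def)
qed

theorem proposition4p1:
  fixes k :: nat
  shows "Abs_fps (\<lambda>n. if n \<ge> k then of_nat (stirling_B n k) / fact n else 0) =
    fps_const (1 / (fact k * 2 ^ k)) * fps_exp 1 * (fps_exp 2 - 1 :: 'a :: field_char_0 fps) ^ k"
  by (rule fps_ext) (simp add: stirling_B_gf_nth stirling_B_eq_0)

end
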